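(* Let $X$ be a non-negative random variable with absolutely continuous distribution function $F$ and finite mean. Then the cumulative residual extropy $\mathcal{CE}(X)$ and the weighted cumulative residual extropy $\mathcal{WCE}(X)$ can be represented in terms of probability weighted moments as $$\mathcal{CE}(X)=-\mathcal{M}_{1,0,1}\quad\text{and}\quad \mathcal{WCE}(X)=-\frac12\mathcal{M}_{2,0,1}.$$
   Context: Let $X_1,X_2$ be independent random variables with distribution function $F$. The two measures are expressed as $$\mathcal{CE}(X)=-\frac12E\big(\min(X_1,X_2)\big),\qquad \mathcal{WCE}(X)=-\frac14E\big(\min(X_1,X_2)^2\big).$$ For real numbers $p,r,s$ for which the involved expectation exists, the probability weighted moment of $X$ is $\mathcal{M}_{p,r,s}=E\{X^pF^r(X)(1-F(X))^s\}$. *)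

theory Defs
  imports "HOL-Probability.Probability"
begin

definition abs_cont :: "(real \<Rightarrow> real) \<Rightarrow> bool" where
  "abs_cont F \<longleftrightarrow>
    (\<forall>e>0. \<exists>d>0. \<forall>(n::nat) (a::nat \<Rightarrow> real) (b::nat \<Rightarrow> real).
      (\<forall>i<n. a i \<le> b i) \<and>
      (\<forall>i<n. \<forall>j<n. i \<noteq> j \<longrightarrow> {a i<..<b i} \<inter> {a j<..<b j} = {}) \<and>
      (\<Sum>i<n. b i - a i) < d
      \<longrightarrow> (\<Sum>i<n. \<bar>F (b i) - F (a i)\<bar>) < e)"

definition distr_fun :: "'a measure \<Rightarrow> ('a \<Rightarrow> real) \<Rightarrow> real \<Rightarrow> real" where
  "distr_fun M X = cdf (distr M borel X)"

(* powr alone is unsuitable: 0 powr 0 = 0, whereas the exponent 0 must give the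
   constant 1, and integer powers of negative reals should be the usual ones. *)
definition rpow :: "real \<Rightarrow> real \<Rightarrow> real" where
  "rpow x a = (if a \<in> \<int> then x powi \<lfloor>a\<rfloor> else x powr a)"

definition pwm_fun :: "'a measure \<Rightarrow> ('a \<Rightarrow> real) \<Rightarrow> real \<Rightarrow> real \<Rightarrow> real \<Rightarrow> 'a \<Rightarrow> real" where
  "pwm_fun M X p r s =
    (\<lambda>\<omega>. rpow (X \<omega>) p * rpow (distr_fun M X (X \<omega>)) r * rpow (1 - distr_fun M X (X \<omega>)) s)"

(* The expectation exists when pwm_fun M X p r s is integrable. *)
definition pwm :: "'a measure \<Rightarrow> ('a \<Rightarrow> real) \<Rightarrow> real \<Rightarrow> real \<Rightarrow> real \<Rightarrow> real" where
  "pwm M X p r s = integral\<^sup>L M (pwm_fun M X p r s)"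

(* The independent copies X1, X2 of X are realised on the product space as X o fst and X o snd.
   By lemmas cum_res_extropy_iid and weighted_cum_res_extropy_iid below, any other independent
   pair with the same distribution function gives the same values. *)
definition cum_res_extropy :: "'a measure \<Rightarrow> ('a \<Rightarrow> real) \<Rightarrow> real" where
  "cum_res_extropy M X =
    - (1/2) * (\<integral>\<omega>. min (X (fst \<omega>)) (X (snd \<omega>)) \<partial>(M \<Otimes>\<^sub>M M))"

definition weighted_cum_res_extropy :: "'a measure \<Rightarrow> ('a \<Rightarrow> real) \<Rightarrow> real" where
  "weighted_cum_res_extropy M X =
    - (1/4) * (\<integral>\<omega>. (min (X (fst \<omega>)) (X (snd \<omega>)))\<^sup>2 \<partial>(M \<Otimes>\<^sub>M M))"

lemma iid_integral_eq:
  fixes h :: "real \<Rightarrow> real \<Rightarrow> real"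
  assumes M: "prob_space M" and X[measurable]: "X \<in> borel_measurable M"
    and N: "prob_space N" and ind: "prob_space.indep_var N borel X1 borel X2"
    and F1: "distr_fun N X1 = distr_fun M X" and F2: "distr_fun N X2 = distr_fun M X"
    and h[measurable]: "(\<lambda>(x, y). h x y) \<in> borel_measurable (borel \<Otimes>\<^sub>M borel)"
  shows "(\<integral>\<omega>. h (X (fst \<omega>)) (X (snd \<omega>)) \<partial>(M \<Otimes>\<^sub>M M)) = (\<integral>\<omega>. h (X1 \<omega>) (X2 \<omega>) \<partial>N)"
proof -
  interpret M: prob_space M by fact
  interpret N: prob_space N by fact
  let ?D = "distr M borel X"
  have m[measurable]: "X1 \<in> borel_measurable N" "X2 \<in> borel_measurable N"
    using N.indep_var_rv1[OF ind] N.indep_var_rv2[OF ind] by auto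
  have D1: "distr N borel X1 = ?D"
    by (rule cdf_unique) (use F1 in \<open>auto simp: distr_fun_def\<close>)
  have D2: "distr N borel X2 = ?D"
    by (rule cdf_unique) (use F2 in \<open>auto simp: distr_fun_def\<close>)
  interpret D: prob_space ?D by (rule M.prob_space_distr) simp
  have "(\<integral>\<omega>. h (X1 \<omega>) (X2 \<omega>) \<partial>N)
      = integral\<^sup>L (distr N (borel \<Otimes>\<^sub>M borel) (\<lambda>\<omega>. (X1 \<omega>, X2 \<omega>))) (\<lambda>(x, y). h x y)"
    by (subst integral_distr) auto
  also have "distr N (borel \<Otimes>\<^sub>M borel) (\<lambda>\<omega>. (X1 \<omega>, X2 \<omega>)) = ?D \<Otimes>\<^sub>M ?D"
    using ind N.indep_var_distribution_eq[of borel X1 borel X2] by (simp add: D1 D2)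
  also have "?D \<Otimes>\<^sub>M ?D = distr (M \<Otimes>\<^sub>M M) (borel \<Otimes>\<^sub>M borel) (\<lambda>(x, y). (X x, X y))"
    by (rule pair_measure_distr) (auto intro: D.sigma_finite_measure_axioms)
  also have "integral\<^sup>L \<dots> (\<lambda>(x, y). h x y) = (\<integral>\<omega>. h (X (fst \<omega>)) (X (snd \<omega>)) \<partial>(M \<Otimes>\<^sub>M M))"
    by (subst integral_distr) (auto simp: case_prod_beta)
  finally show ?thesis by simp
qed

lemma cum_res_extropy_iid:
  assumes "prob_space M" "X \<in> borel_measurable M" "prob_space N"
    "prob_space.indep_var N borel X1 borel X2"
    "distr_fun N X1 = distr_fun M X" "distr_fun N X2 = distr_fun M X"
  shows "cum_res_extropy M X = - (1/2) * (\<integral>\<omega>. min (X1 \<omega>) (X2 \<omega>) \<partial>N)"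
  unfolding cum_res_extropy_def
  using iid_integral_eq[OF assms, of min] by simp

lemma weighted_cum_res_extropy_iid:
  assumes "prob_space M" "X \<in> borel_measurable M" "prob_space N"
    "prob_space.indep_var N borel X1 borel X2"
    "distr_fun N X1 = distr_fun M X" "distr_fun N X2 = distr_fun M X"
  shows "weighted_cum_res_extropy M X = - (1/4) * (\<integral>\<omega>. (min (X1 \<omega>) (X2 \<omega>))\<^sup>2 \<partial>N)"
  unfolding weighted_cum_res_extropy_def
  using iid_integral_eq[OF assms, of "\<lambda>x y. (min x y)\<^sup>2"] by simp

lemma min_copies_tail:
  assumes M: "prob_space M" and X[measurable]: "X \<in> borel_measurable M"
  shows "emeasure (M \<Otimes>\<^sub>M M) {\<omega> \<in> space (M \<Otimes>\<^sub>M M). x < min (X (fst \<omega>)) (X (snd \<omega>))}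
    = ennreal ((1 - distr_fun M X x)\<^sup>2)"
proof -
  interpret M: prob_space M by fact
  interpret MM: pair_prob_space M M ..
  let ?A = "{\<omega> \<in> space M. x < X \<omega>}"
  have "distr_fun M X x = M.prob {\<omega> \<in> space M. X \<omega> \<le> x}"
    unfolding distr_fun_def cdf_def
    by (subst measure_distr) (auto intro!: arg_cong[where f = M.prob])
  moreover have "M.prob ?A = 1 - M.prob {\<omega> \<in> space M. X \<omega> \<le> x}"
    by (subst M.prob_compl[symmetric]) (auto intro!: arg_cong[where f = M.prob])
  ultimately have A: "M.prob ?A = 1 - distr_fun M X x" by simp
  have "{\<omega> \<in> space (M \<Otimes>\<^sub>M M). x < min (X (fst \<omega>)) (X (snd \<omega>))} = ?A \<times> ?A"
    by (auto simp: space_pair_measure)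
  then have "emeasure (M \<Otimes>\<^sub>M M) {\<omega> \<in> space (M \<Otimes>\<^sub>M M). x < min (X (fst \<omega>)) (X (snd \<omega>))}
      = emeasure M ?A * emeasure M ?A"
    by (simp add: M.emeasure_pair_measure_Times)
  also have "\<dots> = ennreal ((1 - distr_fun M X x)\<^sup>2)"
    by (simp add: M.emeasure_eq_measure A[symmetric] power2_eq_square ennreal_mult)
  finally show ?thesis .
qed

lemma min_copies_integral:
  fixes g G :: "real \<Rightarrow> real"
  assumes M: "prob_space M" and X[measurable]: "X \<in> borel_measurable M"
    and nn: "AE \<omega> in M. 0 \<le> X \<omega>"
    and g[measurable]: "g \<in> borel_measurable borel" and g0: "\<And>x. 0 \<le> x \<Longrightarrow> 0 \<le> g x"
    and G[measurable]: "G \<in> borel_measurable borel"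
    and G0: "\<And>y. 0 \<le> y \<Longrightarrow> 0 \<le> G y"
    and gG: "\<And>y. 0 \<le> y \<Longrightarrow> (\<integral>\<^sup>+x. ennreal (g x) * indicator {0..<y} x \<partial>lborel) = ennreal (G y)"
  shows "(\<integral>\<omega>. G (min (X (fst \<omega>)) (X (snd \<omega>))) \<partial>(M \<Otimes>\<^sub>M M))
    = (LBINT x:{0..}. g x * (1 - distr_fun M X x)\<^sup>2)"
proof -
  interpret M: prob_space M by fact
  interpret MM: pair_prob_space M M ..
  interpret P: pair_sigma_finite "M \<Otimes>\<^sub>M M" lborel ..
  define Y where "Y = (\<lambda>\<omega>. min (X (fst \<omega>)) (X (snd \<omega>)))"
  have [measurable]: "Y \<in> borel_measurable (M \<Otimes>\<^sub>M M)" unfolding Y_def by simp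
  interpret D: real_distribution "distr M borel X" by simp
  have [measurable]: "distr_fun M X \<in> borel_measurable borel"
    unfolding distr_fun_def
    by (intro borel_measurable_mono monoI) (rule D.cdf_nondecreasing)
  have Y0: "AE \<omega> in M \<Otimes>\<^sub>M M. 0 \<le> Y \<omega>"
    by (rule MM.AE_pair_measure) (use nn in \<open>auto simp: Y_def\<close>)
  have "(\<integral>\<^sup>+\<omega>. ennreal (G (Y \<omega>)) \<partial>(M \<Otimes>\<^sub>M M))
      = (\<integral>\<^sup>+\<omega>. (\<integral>\<^sup>+x. ennreal (g x) * indicator {0..<Y \<omega>} x \<partial>lborel) \<partial>(M \<Otimes>\<^sub>M M))"
    using Y0 by (intro nn_integral_cong_AE) (auto simp: gG)
  also have "\<dots> = (\<integral>\<^sup>+\<omega>. (\<integral>\<^sup>+x. ennreal (g x) * indicator {0..} x * indicator {\<omega>. x < Y \<omega>} \<omega> \<partial>lborel) \<partial>(M \<Otimes>\<^sub>M M))"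
    by (intro nn_integral_cong) (auto split: split_indicator)
  also have "\<dots> = (\<integral>\<^sup>+x. (\<integral>\<^sup>+\<omega>. ennreal (g x) * indicator {0..} x * indicator {\<omega>. x < Y \<omega>} \<omega> \<partial>(M \<Otimes>\<^sub>M M)) \<partial>lborel)"
    by (rule P.Fubini'[symmetric]) (simp add: indicator_def)
  also have "\<dots> = (\<integral>\<^sup>+x. ennreal (indicator {0..} x *\<^sub>R (g x * (1 - distr_fun M X x)\<^sup>2)) \<partial>lborel)"
  proof (intro nn_integral_cong)
    fix x :: real
    have "(\<integral>\<^sup>+\<omega>. ennreal (g x) * indicator {0..} x * indicator {\<omega>. x < Y \<omega>} \<omega> \<partial>(M \<Otimes>\<^sub>M M))
        = ennreal (g x) * indicator {0..} x * (\<integral>\<^sup>+\<omega>. indicator {\<omega> \<in> space (M \<Otimes>\<^sub>M M). x < Y \<omega>} \<omega> \<partial>(M \<Otimes>\<^sub>M M))"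
      by (subst nn_integral_cmult[symmetric])
        (auto intro!: nn_integral_cong split: split_indicator)
    also have "\<dots> = ennreal (g x) * indicator {0..} x * ennreal ((1 - distr_fun M X x)\<^sup>2)"
      using min_copies_tail[OF M X, of x] by (simp add: Y_def)
    also have "\<dots> = ennreal (indicator {0..} x *\<^sub>R (g x * (1 - distr_fun M X x)\<^sup>2))"
      using g0[of x] by (auto split: split_indicator simp: ennreal_mult)
    finally show "(\<integral>\<^sup>+\<omega>. ennreal (g x) * indicator {0..} x * indicator {\<omega>. x < Y \<omega>} \<omega> \<partial>(M \<Otimes>\<^sub>M M))
        = ennreal (indicator {0..} x *\<^sub>R (g x * (1 - distr_fun M X x)\<^sup>2))" .
  qed
  finally have eq: "(\<integral>\<^sup>+\<omega>. ennreal (G (Y \<omega>)) \<partial>(M \<Otimes>\<^sub>M M))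
      = (\<integral>\<^sup>+x. ennreal (indicator {0..} x *\<^sub>R (g x * (1 - distr_fun M X x)\<^sup>2)) \<partial>lborel)" .
  have "(\<integral>\<omega>. G (Y \<omega>) \<partial>(M \<Otimes>\<^sub>M M)) = enn2real (\<integral>\<^sup>+\<omega>. ennreal (G (Y \<omega>)) \<partial>(M \<Otimes>\<^sub>M M))"
    using Y0 by (intro integral_eq_nn_integral) (auto simp: G0)
  also have "\<dots> = (LBINT x:{0..}. g x * (1 - distr_fun M X x)\<^sup>2)"
    unfolding eq set_lebesgue_integral_def
    by (rule integral_eq_nn_integral[symmetric]) (auto split: split_indicator simp: g0)
  finally show ?thesis unfolding Y_def .
qed

(* The usual definitions of the two measures through the survival function 1 - F. *)
lemma cum_res_extropy_survival:
  assumes "prob_space M" "X \<in> borel_measurable M" "AE \<omega> in M. 0 \<le> X \<omega>"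
  shows "cum_res_extropy M X = - (1/2) * (LBINT x:{0..}. (1 - distr_fun M X x)\<^sup>2)"
proof -
  have "(\<integral>\<omega>. min (X (fst \<omega>)) (X (snd \<omega>)) \<partial>(M \<Otimes>\<^sub>M M))
      = (LBINT x:{0..}. 1 * (1 - distr_fun M X x)\<^sup>2)"
    by (rule min_copies_integral[OF assms, where G = "\<lambda>y. y"]) auto
  then show ?thesis unfolding cum_res_extropy_def by simp
qed

lemma weighted_cum_res_extropy_survival:
  assumes "prob_space M" "X \<in> borel_measurable M" "AE \<omega> in M. 0 \<le> X \<omega>"
  shows "weighted_cum_res_extropy M X = - (1/2) * (LBINT x:{0..}. x * (1 - distr_fun M X x)\<^sup>2)"
proof -
  have "(\<integral>\<^sup>+x. ennreal x * indicator {0..<y} x \<partial>lborel) = ennreal (y\<^sup>2 / 2)" if "0 \<le> y" for y :: real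
  proof -
    have "(\<integral>\<^sup>+x. ennreal x * indicator {0..<y} x \<partial>lborel) = (\<integral>\<^sup>+x. ennreal x * indicator {0..y} x \<partial>lborel)"
      using AE_lborel_singleton[of y]
      by (intro nn_integral_cong_AE) (auto elim!: eventually_mono split: split_indicator)
    also have "\<dots> = ennreal (y\<^sup>2 / 2 - 0\<^sup>2 / 2)"
      by (rule nn_integral_FTC_Icc[where F = "\<lambda>x. x\<^sup>2 / 2"])
        (use that in \<open>auto intro!: derivative_eq_intros\<close>)
    finally show ?thesis by simp
  qed
  note tail = this
  have "(\<integral>\<omega>. (min (X (fst \<omega>)) (X (snd \<omega>)))\<^sup>2 / 2 \<partial>(M \<Otimes>\<^sub>M M))
      = (LBINT x:{0..}. x * (1 - distr_fun M X x)\<^sup>2)"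
    by (rule min_copies_integral[OF assms, where G = "\<lambda>y. y\<^sup>2 / 2"]) (auto simp: tail)
  then show ?thesis unfolding weighted_cum_res_extropy_def by simp
qed

end

(* Since F is continuous, independent copies X1, X2 of X almost surely differ, so for G >= 0 on the
   half line E G(min X1 X2) = E[G(X1); X1 < X2] + E[G(X2); X2 < X1] = 2 E[G(X) (1 - F(X))];
   take G y = y and G y = y^2. The second moment weighted by 1 - F is finite although E X^2 need
   not be, because Markov's inequality x (1 - F x) <= E X gives X^2 (1 - F(X)) <= X E X. *)
theory Submission
  imports Defs
begin

text \<open>A family consisting of one interval already yields continuity, with the same
  \<open>d\<close> at every point. Continuity is what rules out ties between the two copies.\<close>

lemma abs_cont_imp_isCont:
  assumes "abs_cont F"
  shows "isCont F x"
proof (unfold continuous_at_eps_delta, intro allI impI)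
  fix e :: real assume "0 < e"
  with assms[unfolded abs_cont_def, rule_format, of e]
  obtain d where "0 < d" and d: "\<And>(n::nat) (a::nat \<Rightarrow> real) b.
      (\<forall>i<n. a i \<le> b i) \<and> (\<forall>i<n. \<forall>j<n. i \<noteq> j \<longrightarrow> {a i<..<b i} \<inter> {a j<..<b j} = {}) \<and>
      (\<Sum>i<n. b i - a i) < d \<Longrightarrow> (\<Sum>i<n. \<bar>F (b i) - F (a i)\<bar>) < e"
    by blast
  \<comment> \<open>With \<open>n = 1\<close> the disjointness condition is vacuous, and both sums
    have a single term.\<close>
  have ord: "\<bar>F v - F u\<bar> < e" if "u \<le> v" "v - u < d" for u v
    using d[of 1 "\<lambda>_. u" "\<lambda>_. v"] that by simp
  have "dist (F y) (F x) < e" if "dist y x < d" for y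
    using ord[of x y] ord[of y x] that by (auto simp: dist_real_def abs_if split: if_splits)
  then show "\<exists>d>0. \<forall>y. dist y x < d \<longrightarrow> dist (F y) (F x) < e"
    using \<open>0 < d\<close> by blast
qed

text \<open>These exponents are integers, so the \<open>powi\<close> branch applies; in particular
  the factor with exponent 0 is 1 even where the distribution function vanishes.\<close>

lemma rpow_numeral [simp]:
  "rpow x 0 = 1" "rpow x 1 = x" "rpow x (numeral k) = x ^ numeral k"
  by (simp_all add: rpow_def)

context prob_space
begin

lemma borel_measurable_distr_fun:
  assumes [measurable]: "X \<in> borel_measurable M"
  shows "distr_fun M X \<in> borel_measurable borel"
proof -
  interpret D: real_distribution "distr M borel X" by simp
  show ?thesis
    unfolding distr_fun_def by (intro borel_measurable_mono monoI) (rule D.cdf_nondecreasing)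
qed

lemma prob_greater_eq_distr_fun:
  assumes [measurable]: "X \<in> borel_measurable M"
  shows "prob {\<omega> \<in> space M. x < X \<omega>} = 1 - distr_fun M X x"
proof -
  have "distr_fun M X x = prob {\<omega> \<in> space M. X \<omega> \<le> x}"
    unfolding distr_fun_def cdf_def
    by (subst measure_distr) (auto intro!: arg_cong[where f = prob])
  moreover have "prob {\<omega> \<in> space M. x < X \<omega>} = 1 - prob {\<omega> \<in> space M. X \<omega> \<le> x}"
    by (subst prob_compl[symmetric]) (auto intro!: arg_cong[where f = prob])
  ultimately show ?thesis by simp
qed

text \<open>The mass of the law of \<open>X\<close> at a point is the jump of its distribution
  function there.\<close>

lemma AE_neq_of_isCont_distr_fun:
  assumes [measurable]: "X \<in> borel_measurable M" and "isCont (distr_fun M X) x"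
  shows "AE \<omega> in M. X \<omega> \<noteq> x"
proof -
  interpret D: real_distribution "distr M borel X" by simp
  have "measure (distr M borel X) {x} = 0"
    using assms(2) D.isCont_cdf unfolding distr_fun_def by blast
  then have "prob {\<omega> \<in> space M. X \<omega> = x} = 0"
    by (subst (asm) measure_distr) (auto simp: vimage_def Int_def conj_commute)
  then show ?thesis
    by (subst AE_iff_measurable[OF _ refl]) (auto simp: emeasure_eq_measure)
qed

text \<open>Taking \<open>g\<close> with values in \<open>ennreal\<close> lets Tonelli apply without
  integrability, so the identity covers infinite values too.\<close>

lemma nn_integral_min_copies:
  fixes g :: "real \<Rightarrow> ennreal"
  assumes X[measurable]: "X \<in> borel_measurable M"
    and cont: "\<And>x. isCont (distr_fun M X) x"
    and g[measurable]: "g \<in> borel_measurable borel"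
  shows "(\<integral>\<^sup>+\<omega>. g (min (X (fst \<omega>)) (X (snd \<omega>))) \<partial>(M \<Otimes>\<^sub>M M))
    = 2 * (\<integral>\<^sup>+\<omega>. g (X \<omega>) * ennreal (1 - distr_fun M X (X \<omega>)) \<partial>M)"
proof -
  interpret MM: pair_prob_space M M ..
  let ?I = "\<integral>\<^sup>+\<omega>. g (X \<omega>) * ennreal (1 - distr_fun M X (X \<omega>)) \<partial>M"
  \<comment> \<open>Fubini for null sets: for each fixed first coordinate, the second copy hits that
    value of \<open>X\<close> with probability 0.\<close>
  have neq: "AE \<omega> in M \<Otimes>\<^sub>M M. X (snd \<omega>) \<noteq> X (fst \<omega>)"
    by (rule MM.AE_pair_measure)
      (use AE_neq_of_isCont_distr_fun[OF X cont] in auto)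
  \<comment> \<open>With the smaller copy frozen at \<open>X a\<close>, integrating out the other
    one leaves its tail probability beyond \<open>X a\<close>.\<close>
  have inner: "(\<integral>\<^sup>+b. g (X a) * indicator {\<omega>. X a < X \<omega>} b \<partial>M)
      = g (X a) * ennreal (1 - distr_fun M X (X a))" for a
  proof -
    have "(\<integral>\<^sup>+b. g (X a) * indicator {\<omega>. X a < X \<omega>} b \<partial>M)
        = (\<integral>\<^sup>+b. g (X a) * indicator {\<omega> \<in> space M. X a < X \<omega>} b \<partial>M)"
      by (intro nn_integral_cong) (auto split: split_indicator)
    also have "\<dots> = g (X a) * emeasure M {\<omega> \<in> space M. X a < X \<omega>}"
      by (rule nn_integral_cmult_indicator) measurable
    finally show ?thesis
      by (simp add: emeasure_eq_measure prob_greater_eq_distr_fun)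
  qed
  have m1: "(\<lambda>\<omega>. g (X (fst \<omega>)) * indicator {\<omega>. X (fst \<omega>) < X (snd \<omega>)} \<omega>)
      \<in> borel_measurable (M \<Otimes>\<^sub>M M)"
    and m2: "(\<lambda>\<omega>. g (X (snd \<omega>)) * indicator {\<omega>. X (snd \<omega>) < X (fst \<omega>)} \<omega>)
      \<in> borel_measurable (M \<Otimes>\<^sub>M M)"
    by (simp_all add: indicator_def)
  \<comment> \<open>Off the diagonal exactly one of the two indicators is 1, and it selects the copy
    attaining the minimum.\<close>
  have "(\<integral>\<^sup>+\<omega>. g (min (X (fst \<omega>)) (X (snd \<omega>))) \<partial>(M \<Otimes>\<^sub>M M))
      = (\<integral>\<^sup>+\<omega>. g (X (fst \<omega>)) * indicator {\<omega>. X (fst \<omega>) < X (snd \<omega>)} \<omega>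
          + g (X (snd \<omega>)) * indicator {\<omega>. X (snd \<omega>) < X (fst \<omega>)} \<omega> \<partial>(M \<Otimes>\<^sub>M M))"
    by (rule nn_integral_cong_AE)
      (use neq in eventually_elim, auto simp: min_def split: split_indicator)
  also have "\<dots> = (\<integral>\<^sup>+\<omega>. g (X (fst \<omega>)) * indicator {\<omega>. X (fst \<omega>) < X (snd \<omega>)} \<omega> \<partial>(M \<Otimes>\<^sub>M M))
      + (\<integral>\<^sup>+\<omega>. g (X (snd \<omega>)) * indicator {\<omega>. X (snd \<omega>) < X (fst \<omega>)} \<omega> \<partial>(M \<Otimes>\<^sub>M M))"
    by (rule nn_integral_add[OF m1 m2])
  also have "(\<integral>\<^sup>+\<omega>. g (X (fst \<omega>)) * indicator {\<omega>. X (fst \<omega>) < X (snd \<omega>)} \<omega> \<partial>(M \<Otimes>\<^sub>M M)) = ?I"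
    using nn_integral_fst[OF m1] by (simp add: inner[symmetric] indicator_def)
  \<comment> \<open>Here the first coordinate is integrated first, so \<open>inner\<close> applies
    with the roles of the copies exchanged.\<close>
  also have "(\<integral>\<^sup>+\<omega>. g (X (snd \<omega>)) * indicator {\<omega>. X (snd \<omega>) < X (fst \<omega>)} \<omega> \<partial>(M \<Otimes>\<^sub>M M)) = ?I"
    using MM.nn_integral_snd[OF m2] by (simp add: inner[symmetric] indicator_def)
  finally show ?thesis by (simp add: mult_2)
qed

text \<open>Both integrands are nonnegative almost everywhere, so each Bochner integral is
  \<open>enn2real\<close> of a nonnegative integral. If these are infinite, both sides take the
  default value 0 and the identity persists.\<close>

lemma integral_min_copies:
  fixes G :: "real \<Rightarrow> real"
  assumes X[measurable]: "X \<in> borel_measurable M"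
    and nn: "AE \<omega> in M. 0 \<le> X \<omega>"
    and cont: "\<And>x. isCont (distr_fun M X) x"
    and G[measurable]: "G \<in> borel_measurable borel"
    and G0: "\<And>y. 0 \<le> y \<Longrightarrow> 0 \<le> G y"
  shows "(\<integral>\<omega>. G (min (X (fst \<omega>)) (X (snd \<omega>))) \<partial>(M \<Otimes>\<^sub>M M))
    = 2 * (\<integral>\<omega>. G (X \<omega>) * (1 - distr_fun M X (X \<omega>)) \<partial>M)"
proof -
  interpret MM: pair_prob_space M M ..
  note [measurable] = borel_measurable_distr_fun[OF X]
  have F1: "0 \<le> 1 - distr_fun M X x" for x
    by (subst prob_greater_eq_distr_fun[OF X, symmetric]) simp
  have min0: "AE \<omega> in M \<Otimes>\<^sub>M M. 0 \<le> min (X (fst \<omega>)) (X (snd \<omega>))"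
    by (rule MM.AE_pair_measure) (use nn in auto)
  have "(\<integral>\<omega>. G (min (X (fst \<omega>)) (X (snd \<omega>))) \<partial>(M \<Otimes>\<^sub>M M))
      = enn2real (\<integral>\<^sup>+\<omega>. ennreal (G (min (X (fst \<omega>)) (X (snd \<omega>)))) \<partial>(M \<Otimes>\<^sub>M M))"
    by (rule integral_eq_nn_integral, simp) (use min0 in eventually_elim, rule G0)
  also have "\<dots> = enn2real (2 * (\<integral>\<^sup>+\<omega>. ennreal (G (X \<omega>)) * ennreal (1 - distr_fun M X (X \<omega>)) \<partial>M))"
    by (subst nn_integral_min_copies[OF X cont]) simp_all
  also have "(\<integral>\<^sup>+\<omega>. ennreal (G (X \<omega>)) * ennreal (1 - distr_fun M X (X \<omega>)) \<partial>M)
      = (\<integral>\<^sup>+\<omega>. ennreal (G (X \<omega>) * (1 - distr_fun M X (X \<omega>))) \<partial>M)"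
    by (rule nn_integral_cong_AE) (use nn in eventually_elim, rule ennreal_mult[symmetric, OF G0 F1])
  also have "enn2real (2 * \<dots>) = 2 * (\<integral>\<omega>. G (X \<omega>) * (1 - distr_fun M X (X \<omega>)) \<partial>M)"
    by (subst integral_eq_nn_integral, simp)
      (use nn in eventually_elim, rule mult_nonneg_nonneg[OF G0 F1], assumption, simp add: enn2real_mult)
  finally show ?thesis .
qed

text \<open>Markov's inequality for the strict tail event: \<open>x\<close> times its indicator lies
  below \<open>X\<close> almost everywhere.\<close>

lemma mult_survival_le_expectation:
  assumes int: "integrable M X" and nn: "AE \<omega> in M. 0 \<le> X \<omega>" and "0 \<le> x"
  shows "x * (1 - distr_fun M X x) \<le> expectation X"
proof -
  have [measurable]: "X \<in> borel_measurable M" using int by simp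
  have "x * (1 - distr_fun M X x) = (\<integral>\<omega>. x * indicator {\<omega> \<in> space M. x < X \<omega>} \<omega> \<partial>M)"
    by (simp add: prob_greater_eq_distr_fun[symmetric])
  also have "\<dots> \<le> expectation X"
  proof (rule integral_mono_AE[OF _ int])
    show "integrable M (\<lambda>\<omega>. x * indicator {\<omega> \<in> space M. x < X \<omega>} \<omega>)"
      by (auto simp: emeasure_eq_measure)
    show "AE \<omega> in M. x * indicator {\<omega> \<in> space M. x < X \<omega>} \<omega> \<le> X \<omega>"
      using nn by eventually_elim (auto split: split_indicator)
  qed
  finally show ?thesis .
qed

end

theorem mainTheorem10:
  fixes M :: "'a measure" and X :: "'a \<Rightarrow> real"
  assumes "prob_space M"
    and "X \<in> borel_measurable M"
    and "AE \<omega> in M. 0 \<le> X \<omega>"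
    and "abs_cont (distr_fun M X)"
    and "integrable M X"
  shows "integrable M (pwm_fun M X 1 0 1) \<and>
    cum_res_extropy M X = - pwm M X 1 0 1 \<and>
    integrable M (pwm_fun M X 2 0 1) \<and>
    weighted_cum_res_extropy M X = - (1/2) * pwm M X 2 0 1"
proof (intro conjI)
  interpret prob_space M by fact
  note X[measurable] = assms(2) and nn = assms(3) and int = assms(5)
  note cont = abs_cont_imp_isCont[OF assms(4)]
  note [measurable] = borel_measurable_distr_fun[OF X]
  let ?S = "\<lambda>x. 1 - distr_fun M X x"
  have S: "0 \<le> ?S x" "?S x \<le> 1" for x
    by (subst prob_greater_eq_distr_fun[OF X, symmetric], simp)+
  have f1: "pwm_fun M X 1 0 1 = (\<lambda>\<omega>. X \<omega> * ?S (X \<omega>))"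
    and f2: "pwm_fun M X 2 0 1 = (\<lambda>\<omega>. (X \<omega>)\<^sup>2 * ?S (X \<omega>))"
    by (simp_all add: pwm_fun_def)
  \<comment> \<open>The survival factor lies in [0, 1], so \<open>X\<close> itself
    dominates.\<close>
  show "integrable M (pwm_fun M X 1 0 1)"
    unfolding f1
    by (rule Bochner_Integration.integrable_bound[OF int])
      (use S in \<open>auto simp: abs_mult intro!: mult_left_le\<close>)
  show "integrable M (pwm_fun M X 2 0 1)"
    unfolding f2
  proof (rule Bochner_Integration.integrable_bound)
    \<comment> \<open>The dominating function is linear in \<open>X\<close>: one factor
      \<open>X\<close> is absorbed together with the survival factor by Markov's inequality at the
      level \<open>X \<omega>\<close>.\<close>
    show "integrable M (\<lambda>\<omega>. X \<omega> * expectation X)" using int by simp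
    have "norm ((X \<omega>)\<^sup>2 * ?S (X \<omega>)) \<le> norm (X \<omega> * expectation X)" if "0 \<le> X \<omega>" for \<omega>
    proof -
      have "(X \<omega>)\<^sup>2 * ?S (X \<omega>) = X \<omega> * (X \<omega> * ?S (X \<omega>))"
        by (simp add: power2_eq_square)
      also have "\<dots> \<le> X \<omega> * expectation X"
        using that by (intro mult_left_mono mult_survival_le_expectation[OF int nn])
      finally show ?thesis using S[of "X \<omega>"] by simp
    qed
    then show "AE \<omega> in M. norm ((X \<omega>)\<^sup>2 * ?S (X \<omega>)) \<le> norm (X \<omega> * expectation X)"
      using nn by (auto elim: eventually_mono)
  qed simp
  show "cum_res_extropy M X = - pwm M X 1 0 1"
    unfolding cum_res_extropy_def pwm_def f1
    \<comment> \<open>The factor 2 from the two orderings cancels the 1/2 here, and turns 1/4 into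
      1/2 in the weighted case.\<close>
    using integral_min_copies[OF X nn cont, of "\<lambda>y. y"] by simp
  show "weighted_cum_res_extropy M X = - (1/2) * pwm M X 2 0 1"
    unfolding weighted_cum_res_extropy_def pwm_def f2
    using integral_min_copies[OF X nn cont, of "\<lambda>y. y\<^sup>2"] by simp
qed

end
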